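(* Let $(X,\tau_1,\tau_2)$ be a bitopological space with $\tau_1\subset\tau_2$. (1) If $(X,\tau_1,\tau_2)$ is $1$-submaximal, then it is $d$-nodec and $p$-nodec. (2) If $(X,\tau_1,\tau_2)$ is $(1,2)$-submaximal, then it is $(2,1)$-nodec. (3) If $\tau_1<_C\tau_2$ and $(X,\tau_1,\tau_2)$ is $(1,2)$-submaximal, then it is $1$-nodec. (4) If $\tau_1<_N\tau_2$ or $\tau_1<_S\tau_2$, and $(X,\tau_1,\tau_2)$ is $(1,2)$-submaximal, then it is $d$-nodec and $p$-nodec.
   Context: A bitopological space is a set with two topologies; $\tau_i\mathrm{cl}$, $\tau_i\mathrm{int}$ are closure and interior in $\tau_i$. Always $i,j\in\{1,2\}$, $i\neq j$. $\tau_1<_C\tau_2$: $\tau_1\subset\tau_2$ and $\tau_1\mathrm{cl}\,U\subseteq\tau_2\mathrm{cl}\,U$ for every $U\in\tau_1$. $\tau_1<_N\tau_2$: $\tau_1\subset\tau_2$ and $\tau_1\mathrm{cl}\,U\subseteq\tau_2\mathrm{cl}\,U$ for every $U\in\tau_2$. $\tau_1<_S\tau_2$: $\tau_1\subset\tau_2$ and, for every $A\subset X$, $\tau_1\mathrm{int}\,A\subset\tau_1\mathrm{cl}\,\tau_2\mathrm{int}\,A$ and $\tau_2\mathrm{int}\,A\subset\tau_2\mathrm{cl}\,\tau_1\mathrm{int}\,A$. $X$ is $(i,j)$-submaximal if every subset of $X$ is of the form $U\cap F$ with $U\in\tau_i$ and $F$ $\tau_j$-closed; it is $i$-submaximal if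 every subset is the intersection of a $\tau_i$-open and a $\tau_i$-closed set. A set $A$ is $i$-discrete if every point of $A$ is $\tau_i$-isolated in $A$. $X$ is $(i,j)$-nodec if every $A\subset X$ with $\tau_i\mathrm{int}\,\tau_j\mathrm{cl}\,A=\varnothing$ is $\tau_j$-closed and $i$-discrete; $X$ is $i$-nodec if every $A\subset X$ with $\tau_i\mathrm{int}\,\tau_i\mathrm{cl}\,A=\varnothing$ is $\tau_i$-closed and $i$-discrete. $d$-nodec means 1-nodec and 2-nodec; $p$-nodec means $(1,2)$-nodec and $(2,1)$-nodec. *)

theory Defs
  imports "HOL-Analysis.Abstract_Topology"
begin

definition bitopological_space :: "'a set \<Rightarrow> 'a topology \<Rightarrow> 'a topology \<Rightarrow> bool" where
  "bitopological_space X \<tau>\<^sub>1 \<tau>\<^sub>2 \<longleftrightarrow> topspace \<tau>\<^sub>1 = X \<and> topspace \<tau>\<^sub>2 = X"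

text \<open>
  The predicates below take the topologies as arguments, in the order of the indices: a property
  written with prefix \<open>(i,j)\<close> becomes a predicate applied to the \<open>i\<close>-th and then the \<open>j\<close>-th
  topology, and one with prefix \<open>i\<close> a predicate of the \<open>i\<close>-th topology alone. They are meant for
  topologies with the same underlying set.
\<close>

definition coarser :: "'a topology \<Rightarrow> 'a topology \<Rightarrow> bool" where
  "coarser \<tau>\<^sub>1 \<tau>\<^sub>2 \<longleftrightarrow> (\<forall>U. openin \<tau>\<^sub>1 U \<longrightarrow> openin \<tau>\<^sub>2 U)"

definition less_C :: "'a topology \<Rightarrow> 'a topology \<Rightarrow> bool" where
  "less_C \<tau>\<^sub>1 \<tau>\<^sub>2 \<longleftrightarrow> coarser \<tau>\<^sub>1 \<tau>\<^sub>2 \<and>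
     (\<forall>U. openin \<tau>\<^sub>1 U \<longrightarrow> \<tau>\<^sub>1 closure_of U \<subseteq> \<tau>\<^sub>2 closure_of U)"

definition less_N :: "'a topology \<Rightarrow> 'a topology \<Rightarrow> bool" where
  "less_N \<tau>\<^sub>1 \<tau>\<^sub>2 \<longleftrightarrow> coarser \<tau>\<^sub>1 \<tau>\<^sub>2 \<and>
     (\<forall>U. openin \<tau>\<^sub>2 U \<longrightarrow> \<tau>\<^sub>1 closure_of U \<subseteq> \<tau>\<^sub>2 closure_of U)"

definition less_S :: "'a topology \<Rightarrow> 'a topology \<Rightarrow> bool" where
  "less_S \<tau>\<^sub>1 \<tau>\<^sub>2 \<longleftrightarrow> coarser \<tau>\<^sub>1 \<tau>\<^sub>2 \<and>
     (\<forall>A. A \<subseteq> topspace \<tau>\<^sub>1 \<longrightarrow>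
        \<tau>\<^sub>1 interior_of A \<subseteq> \<tau>\<^sub>1 closure_of (\<tau>\<^sub>2 interior_of A) \<and>
        \<tau>\<^sub>2 interior_of A \<subseteq> \<tau>\<^sub>2 closure_of (\<tau>\<^sub>1 interior_of A))"

definition ij_submaximal :: "'a topology \<Rightarrow> 'a topology \<Rightarrow> bool" where
  "ij_submaximal \<tau>\<^sub>i \<tau>\<^sub>j \<longleftrightarrow>
     (\<forall>A. A \<subseteq> topspace \<tau>\<^sub>i \<longrightarrow> (\<exists>U F. openin \<tau>\<^sub>i U \<and> closedin \<tau>\<^sub>j F \<and> A = U \<inter> F))"

definition i_submaximal :: "'a topology \<Rightarrow> bool" where
  "i_submaximal \<tau>\<^sub>i \<longleftrightarrow>
     (\<forall>A. A \<subseteq> topspace \<tau>\<^sub>i \<longrightarrow> (\<exists>U F. openin \<tau>\<^sub>i U \<and> closedin \<tau>\<^sub>i F \<and> A = U \<inter> F))"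

definition isolated_point :: "'a topology \<Rightarrow> 'a \<Rightarrow> 'a set \<Rightarrow> bool" where
  "isolated_point \<tau> x A \<longleftrightarrow> x \<in> A \<and> (\<exists>U. openin \<tau> U \<and> U \<inter> A = {x})"

definition i_discrete :: "'a topology \<Rightarrow> 'a set \<Rightarrow> bool" where
  "i_discrete \<tau>\<^sub>i A \<longleftrightarrow> (\<forall>x\<in>A. isolated_point \<tau>\<^sub>i x A)"

definition ij_nodec :: "'a topology \<Rightarrow> 'a topology \<Rightarrow> bool" where
  "ij_nodec \<tau>\<^sub>i \<tau>\<^sub>j \<longleftrightarrow>
     (\<forall>A. A \<subseteq> topspace \<tau>\<^sub>i \<longrightarrow> \<tau>\<^sub>i interior_of (\<tau>\<^sub>j closure_of A) = {} \<longrightarrow>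
        closedin \<tau>\<^sub>j A \<and> i_discrete \<tau>\<^sub>i A)"

definition i_nodec :: "'a topology \<Rightarrow> bool" where
  "i_nodec \<tau>\<^sub>i \<longleftrightarrow>
     (\<forall>A. A \<subseteq> topspace \<tau>\<^sub>i \<longrightarrow> \<tau>\<^sub>i interior_of (\<tau>\<^sub>i closure_of A) = {} \<longrightarrow>
        closedin \<tau>\<^sub>i A \<and> i_discrete \<tau>\<^sub>i A)"

definition d_nodec :: "'a topology \<Rightarrow> 'a topology \<Rightarrow> bool" where
  "d_nodec \<tau>\<^sub>1 \<tau>\<^sub>2 \<longleftrightarrow> i_nodec \<tau>\<^sub>1 \<and> i_nodec \<tau>\<^sub>2"

definition p_nodec :: "'a topology \<Rightarrow> 'a topology \<Rightarrow> bool" where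
  "p_nodec \<tau>\<^sub>1 \<tau>\<^sub>2 \<longleftrightarrow> ij_nodec \<tau>\<^sub>1 \<tau>\<^sub>2 \<and> ij_nodec \<tau>\<^sub>2 \<tau>\<^sub>1"

end

theory Submission
  imports Defs
begin

text \<open>
  A set with empty \<open>\<tau>\<^sub>j\<close>-interior has \<open>\<tau>\<^sub>j\<close>-dense complement, so writing the complement as
  \<open>U \<inter> F\<close> forces \<open>F = X\<close>: in an \<open>(i,j)\<close>-submaximal space such a set is \<open>\<tau>\<^sub>i\<close>-closed. The same holds
  for all its subsets, so it is also \<open>\<tau>\<^sub>i\<close>-discrete. Each nodec property thus reduces to showing that
  the sets \<open>A\<close> in question have empty \<open>\<tau>\<^sub>j\<close>-interior. Where this is not immediate from
  \<open>\<tau>\<^sub>1 \<subseteq> \<tau>\<^sub>2\<close>, the relations \<open><\<^sub>C\<close> and \<open><\<^sub>N\<close> turn \<open>\<tau>\<^sub>1\<close>-density of the open complement of the closure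
  of \<open>A\<close> into \<open>\<tau>\<^sub>2\<close>-density, and \<open><\<^sub>S\<close> gives it for \<open>A\<close> itself.
\<close>

lemma i_submaximal_iff: "i_submaximal \<tau> \<longleftrightarrow> ij_submaximal \<tau> \<tau>"
  by (simp add: i_submaximal_def ij_submaximal_def)

lemma closedin_if_interior_of_empty:
  assumes sub: "ij_submaximal \<tau>\<^sub>i \<tau>\<^sub>j" and top: "topspace \<tau>\<^sub>i = topspace \<tau>\<^sub>j"
    and A: "A \<subseteq> topspace \<tau>\<^sub>i" and int: "\<tau>\<^sub>j interior_of A = {}"
  shows "closedin \<tau>\<^sub>i A"
proof -
  obtain U F where U: "openin \<tau>\<^sub>i U" and F: "closedin \<tau>\<^sub>j F" and eq: "topspace \<tau>\<^sub>i - A = U \<inter> F"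
    using sub unfolding ij_submaximal_def by (meson Diff_subset)
  have "\<tau>\<^sub>j closure_of (topspace \<tau>\<^sub>j - A) \<subseteq> F"
    using eq top F by (intro closure_of_minimal) auto
  then have "topspace \<tau>\<^sub>j \<subseteq> F"
    by (simp add: closure_of_complement int)
  then have "topspace \<tau>\<^sub>i - A = U"
    using eq openin_subset[OF U] top by blast
  then show ?thesis
    using A U by (simp add: closedin_def)
qed

lemma i_discrete_if_interior_of_empty:
  assumes sub: "ij_submaximal \<tau>\<^sub>i \<tau>\<^sub>j" and top: "topspace \<tau>\<^sub>i = topspace \<tau>\<^sub>j"
    and A: "A \<subseteq> topspace \<tau>\<^sub>i" and int: "\<tau>\<^sub>j interior_of A = {}"
  shows "i_discrete \<tau>\<^sub>i A"
  unfolding i_discrete_def isolated_point_def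
proof (intro ballI conjI exI)
  fix x assume x: "x \<in> A"
  \<comment> \<open>Removing \<open>x\<close> keeps the interior empty; the complement of the closed
    set \<open>A - {x}\<close> then isolates \<open>x\<close>.\<close>
  have "\<tau>\<^sub>j interior_of (A - {x}) = {}"
    using int interior_of_mono[of "A - {x}" A \<tau>\<^sub>j] by blast
  then have "closedin \<tau>\<^sub>i (A - {x})"
    using A by (intro closedin_if_interior_of_empty[OF sub top]) auto
  then show "openin \<tau>\<^sub>i (topspace \<tau>\<^sub>i - (A - {x}))"
    by (rule openin_diff[OF openin_topspace])
  show "(topspace \<tau>\<^sub>i - (A - {x})) \<inter> A = {x}"
    using x A by blast
qed

lemma closedin_coarser:
  assumes "coarser \<tau>\<^sub>1 \<tau>\<^sub>2" "topspace \<tau>\<^sub>1 = topspace \<tau>\<^sub>2" "closedin \<tau>\<^sub>1 A"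
  shows "closedin \<tau>\<^sub>2 A"
  using assms by (simp add: coarser_def closedin_def)

lemma i_discrete_coarser:
  assumes "coarser \<tau>\<^sub>1 \<tau>\<^sub>2" "i_discrete \<tau>\<^sub>1 A"
  shows "i_discrete \<tau>\<^sub>2 A"
  using assms unfolding coarser_def i_discrete_def isolated_point_def by meson

lemma interior_of_coarser:
  assumes "coarser \<tau>\<^sub>1 \<tau>\<^sub>2"
  shows "\<tau>\<^sub>1 interior_of A \<subseteq> \<tau>\<^sub>2 interior_of A"
  using assms unfolding coarser_def interior_of_def by blast

lemma interior_of_closure_of_empty:
  assumes "A \<subseteq> topspace \<tau>\<^sub>j" "\<tau>\<^sub>i interior_of (\<tau>\<^sub>j closure_of A) = {}"
  shows "\<tau>\<^sub>i interior_of A = {}"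
  using assms interior_of_mono[OF closure_of_subset[OF assms(1)]] by blast

text \<open>Empty interior of \<open>B\<close> means dense complement, and the closure inclusion
  carries this density over to the second topology.\<close>

lemma interior_of_empty_transfer:
  assumes "topspace \<tau>\<^sub>1 = topspace \<tau>\<^sub>2"
    and "\<tau>\<^sub>1 closure_of (topspace \<tau>\<^sub>1 - B) \<subseteq> \<tau>\<^sub>2 closure_of (topspace \<tau>\<^sub>1 - B)"
    and "\<tau>\<^sub>1 interior_of B = {}"
  shows "\<tau>\<^sub>2 interior_of B = {}"
  using assms closure_of_complement[of \<tau>\<^sub>1 B] closure_of_complement[of \<tau>\<^sub>2 B]
    interior_of_subset_topspace[of \<tau>\<^sub>2 B] by auto

lemma less_C_interior_of_empty:
  assumes "less_C \<tau>\<^sub>1 \<tau>\<^sub>2" "topspace \<tau>\<^sub>1 = topspace \<tau>\<^sub>2"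
    and "closedin \<tau>\<^sub>1 B" "\<tau>\<^sub>1 interior_of B = {}"
  shows "\<tau>\<^sub>2 interior_of B = {}"
  using assms by (intro interior_of_empty_transfer[of \<tau>\<^sub>1 \<tau>\<^sub>2]) (auto simp: less_C_def closedin_def)

text \<open>The complement of \<open>B\<close> is only \<open>\<tau>\<^sub>2\<close>-open here,
  which is exactly the class of sets that \<open>less_N\<close> controls.\<close>

lemma less_N_interior_of_empty:
  assumes "less_N \<tau>\<^sub>1 \<tau>\<^sub>2" "topspace \<tau>\<^sub>1 = topspace \<tau>\<^sub>2"
    and "closedin \<tau>\<^sub>2 B" "\<tau>\<^sub>1 interior_of B = {}"
  shows "\<tau>\<^sub>2 interior_of B = {}"
  using assms by (intro interior_of_empty_transfer[of \<tau>\<^sub>1 \<tau>\<^sub>2]) (auto simp: less_N_def closedin_def)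

lemma less_S_interior_of_empty:
  assumes "less_S \<tau>\<^sub>1 \<tau>\<^sub>2" "B \<subseteq> topspace \<tau>\<^sub>1" "\<tau>\<^sub>1 interior_of B = {}"
  shows "\<tau>\<^sub>2 interior_of B = {}"
proof -
  have "\<tau>\<^sub>2 interior_of B \<subseteq> \<tau>\<^sub>2 closure_of (\<tau>\<^sub>1 interior_of B)"
    using assms unfolding less_S_def by blast
  then show ?thesis
    by (simp add: assms(3))
qed

lemma less_N_imp_less_C: "less_N \<tau>\<^sub>1 \<tau>\<^sub>2 \<Longrightarrow> less_C \<tau>\<^sub>1 \<tau>\<^sub>2"
  by (simp add: less_N_def less_C_def coarser_def)

theorem corollary3p7:
  fixes X :: "'a set" and \<tau>\<^sub>1 \<tau>\<^sub>2 :: "'a topology"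
  assumes "bitopological_space X \<tau>\<^sub>1 \<tau>\<^sub>2"
    and "coarser \<tau>\<^sub>1 \<tau>\<^sub>2"
  shows "(i_submaximal \<tau>\<^sub>1 \<longrightarrow> d_nodec \<tau>\<^sub>1 \<tau>\<^sub>2 \<and> p_nodec \<tau>\<^sub>1 \<tau>\<^sub>2)
    \<and> (ij_submaximal \<tau>\<^sub>1 \<tau>\<^sub>2 \<longrightarrow> ij_nodec \<tau>\<^sub>2 \<tau>\<^sub>1)
    \<and> (less_C \<tau>\<^sub>1 \<tau>\<^sub>2 \<and> ij_submaximal \<tau>\<^sub>1 \<tau>\<^sub>2 \<longrightarrow> i_nodec \<tau>\<^sub>1)
    \<and> ((less_N \<tau>\<^sub>1 \<tau>\<^sub>2 \<or> less_S \<tau>\<^sub>1 \<tau>\<^sub>2) \<and> ij_submaximal \<tau>\<^sub>1 \<tau>\<^sub>2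
         \<longrightarrow> d_nodec \<tau>\<^sub>1 \<tau>\<^sub>2 \<and> p_nodec \<tau>\<^sub>1 \<tau>\<^sub>2)"
proof -
  have top: "topspace \<tau>\<^sub>1 = topspace \<tau>\<^sub>2"
    using assms(1) by (simp add: bitopological_space_def)
  note coarse = assms(2)
  \<comment> \<open>\<open>\<tau>\<^sub>j\<close> stays arbitrary to serve both kinds of
    submaximality; the \<open>\<tau>\<^sub>2\<close> half follows from the
    \<open>\<tau>\<^sub>1\<close> half by refinement.\<close>
  have small: "closedin \<tau>\<^sub>1 A \<and> i_discrete \<tau>\<^sub>1 A \<and> closedin \<tau>\<^sub>2 A \<and> i_discrete \<tau>\<^sub>2 A"
    if "ij_submaximal \<tau>\<^sub>1 \<tau>\<^sub>j" "topspace \<tau>\<^sub>1 = topspace \<tau>\<^sub>j" "A \<subseteq> topspace \<tau>\<^sub>1"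
      "\<tau>\<^sub>j interior_of A = {}" for A \<tau>\<^sub>j
    using closedin_if_interior_of_empty[OF that] i_discrete_if_interior_of_empty[OF that]
      closedin_coarser[OF coarse top] i_discrete_coarser[OF coarse] by blast
  have int21: "\<tau>\<^sub>1 interior_of A = {}" if "\<tau>\<^sub>2 interior_of A = {}" for A
    using that interior_of_coarser[OF coarse, of A] by blast
  have emp1: "\<tau> interior_of A = {}"
    if "A \<subseteq> topspace \<tau>\<^sub>1" "\<tau> interior_of (\<tau>\<^sub>1 closure_of A) = {}" for A \<tau>
    using that by (rule interior_of_closure_of_empty)
  have emp2: "\<tau> interior_of A = {}"
    if "A \<subseteq> topspace \<tau>\<^sub>1" "\<tau> interior_of (\<tau>\<^sub>2 closure_of A) = {}" for A \<tau>
    using that unfolding top by (rule interior_of_closure_of_empty)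
  note nodec_defs = d_nodec_def p_nodec_def i_nodec_def ij_nodec_def top[symmetric]
  have 1: "d_nodec \<tau>\<^sub>1 \<tau>\<^sub>2 \<and> p_nodec \<tau>\<^sub>1 \<tau>\<^sub>2" if "i_submaximal \<tau>\<^sub>1"
  proof -
    have "ij_submaximal \<tau>\<^sub>1 \<tau>\<^sub>1"
      using that by (simp add: i_submaximal_iff)
    note small = small[OF this refl]
    show ?thesis
      unfolding nodec_defs
      \<comment> \<open>All four cases come down to empty \<open>\<tau>\<^sub>1\<close>-interior of
        \<open>A\<close>; \<open>int21\<close> handles the two where the given interior is taken in
        \<open>\<tau>\<^sub>2\<close>.\<close>
      by (simp add: small emp1 emp2 int21)
  qed
  have 2: "i_nodec \<tau>\<^sub>2 \<and> ij_nodec \<tau>\<^sub>2 \<tau>\<^sub>1" if sub: "ij_submaximal \<tau>\<^sub>1 \<tau>\<^sub>2"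
    unfolding nodec_defs
    by (simp add: small[OF sub top] emp1 emp2)
  have 3: "i_nodec \<tau>\<^sub>1" if C: "less_C \<tau>\<^sub>1 \<tau>\<^sub>2" and sub: "ij_submaximal \<tau>\<^sub>1 \<tau>\<^sub>2"
    unfolding nodec_defs
    \<comment> \<open>The transfer is applied to the closure of \<open>A\<close>, and only then does
      \<open>emp1\<close> pass to \<open>A\<close>.\<close>
    by (simp add: small[OF sub top] emp1 less_C_interior_of_empty[OF C top closedin_closure_of])
  have 4: "ij_nodec \<tau>\<^sub>1 \<tau>\<^sub>2" if N: "less_N \<tau>\<^sub>1 \<tau>\<^sub>2" and sub: "ij_submaximal \<tau>\<^sub>1 \<tau>\<^sub>2"
    unfolding nodec_defs
    by (simp add: small[OF sub top] emp2 less_N_interior_of_empty[OF N top closedin_closure_of])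
  have 5: "i_nodec \<tau>\<^sub>1 \<and> ij_nodec \<tau>\<^sub>1 \<tau>\<^sub>2" if S: "less_S \<tau>\<^sub>1 \<tau>\<^sub>2" and sub: "ij_submaximal \<tau>\<^sub>1 \<tau>\<^sub>2"
    unfolding nodec_defs
    \<comment> \<open>Here the order is reversed: first pass to \<open>A\<close>, then transfer,
      since \<open>less_S\<close> applies to arbitrary sets.\<close>
    by (simp add: small[OF sub top] emp1 emp2 less_S_interior_of_empty[OF S])
  \<comment> \<open>In the last claim, \<open>less_N\<close> combines \<open>2\<close>,
    \<open>4\<close> and, through \<open>less_C\<close>, \<open>3\<close>; \<open>less_S\<close>
    combines \<open>2\<close> and \<open>5\<close>.\<close>
  show ?thesis
    using 1 2 3 4 5 less_N_imp_less_C[of \<tau>\<^sub>1 \<tau>\<^sub>2] unfolding d_nodec_def p_nodec_def by blast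
qed

end
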